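(* Let $C:C(I)\to\mathbb{R}$ be a linear continuous functional and $\delta_1,\ldots,\delta_n\in\mathbb{R}$. Assume that the homogeneous two-point problem \[ T_n[M]u(t)=0,\ t\in I,\qquad B_i(u)=0,\ i=1,\ldots,n, \] has $u=0$ as its unique solution, and let $g_M$ be its unique Green's function. For $j\in\{1,\ldots,n\}$ let $\omega_j$ be the unique solution of \[ T_n[M]u(t)=0,\ t\in I,\qquad B_k(u)=0 \text{ for } k\neq j,\qquad B_j(u)=1 . \] Assume that $\sum_{i=1}^n\delta_i\,C(\omega_i)\neq 1$ and let \[ G(t,s,\delta_1,\ldots,\delta_n,M)=g_M(t,s)+\frac{\sum_{i=1}^n\delta_i\,\omega_i(t)}{1-\sum_{j=1}^n\delta_j\,C(\omega_j)}\,C\bigl(g_M(\cdot,s)\bigr) \] be the Green's function related to the problem \[ T_n[M]u(t)=\sigma(t),\ t\in I,\qquad B_i(u)=\delta_i\,C(u),\ i=1,\ldots,n. \] Suppose that the following hypotheses are satisfied: (a) $\sum_{j=1}^n\delta_j\,C(\omega_j)<1$. (b) $\delta_i\,\omega_i(t)\ge 0$ for all $t\in I$, $i=1,\ldots,n$. (c) If $u\ge 0$ on $I$, then $C(u)\ge 0$. Then the following assertions are fulfilled: (i) If $g_M(t,s)\ge 0$ for all $(t,s)\in I\times I$, then $G(t,s,\delta_1,\ldots,\delta_n,M)\ge g_M(t,s)\ge 0$ for all $(t,s)\in I\times I$. (ii) If $g_M(t,s)\le 0$ for all $(t,s)\in I\times I$, then $G(t,s,\delta_1,\ldots,\delta_n,M)\le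 g_M(t,s)\le 0$ for all $(t,s)\in I\times I$.
   Context: Let $n\ge 1$, $I=[a,b]$ a compact real interval, $M\in\mathbb{R}$, and let $a_1,\ldots,a_n$ be continuous real functions on $I$. For $u\in C^n(I)$ put \[ T_n[M]u(t)=u^{(n)}(t)+a_1(t)u^{(n-1)}(t)+\cdots+a_n(t)u(t)+M\,u(t),\quad t\in I. \] For $i=1,\ldots,n$ the two-point boundary operators are \[ B_i(u)=\sum_{j=0}^{n-1}\left(\alpha_j^i u^{(j)}(a)+\beta_j^i u^{(j)}(b)\right), \] with real constants $\alpha_j^i,\beta_j^i$. $C(I)$ carries the supremum norm. Solutions are functions in $C^n(I)$. When the homogeneous problem $T_n[M]u=0$, $B_i(u)=0$ ($i=1,\ldots,n$) has only the trivial solution, its Green's function $g_M:I\times I\to\mathbb{R}$ is the (unique) function such that: $g_M$ and its $t$-derivatives up to order $n-2$ are continuous on $I\times I$ (no condition if $n=1$); on each of the triangles $\{a\le s<t\le b\}$ and $\{a\le t<s\le b\}$, $g_M$ and its $t$-derivatives up to order $n$ exist, are continuous, extend continuously to the closed triangle, and satisfy $T_n[M]g_M(\cdot,s)=0$; for $s\in(a,b)$ the jump $\partial_t^{n-1}g_M(s^+,s)-\partial_t^{n-1}g_M(s^-,s)$ equals $1$; and $B_i(g_M(\cdot,s))=0$ for $s\in(a,b)$, $i=1,\ldots,n$. For every $\sigma\in C(I)$, $v(t)=\int_a^b g_M(t,s)\sigma(s)\,ds$ is the unique solution of $T_n[M]v=\sigma$, $B_i(v)=0$, $i=1,\ldots,n$.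 When this Green's function exists, the functions $\omega_j$ exist and are unique. The Green's function $G$ of the non-local problem is the kernel for which the unique solution of that problem is $u(t)=\int_a^b G(t,s,\delta_1,\ldots,\delta_n,M)\sigma(s)\,ds$; it is given by the formula displayed in the claim. Convention when $n=1$: $g_M$ has a jump on the diagonal $t=s$; its diagonal values are taken as the continuous extension from one (fixed) of the two triangles, and $C(g_M(\cdot,s))$ is understood by extending $C$ to bounded Borel functions via integration against its Riesz representing finite signed measure. For $n\ge 2$, $g_M(\cdot,s)\in C(I)$ and no convention is needed. Hypothesis (c) is for $u\in C(I)$. *)

theory Defs
  imports "HOL-Analysis.Analysis"
begin

text \<open>
  Functions on the interval \<open>I = [a,b]\<close> are total functions \<open>real \<Rightarrow> real\<close> of which only the
  restriction to \<open>{a..b}\<close> matters. Derivatives are taken within \<open>{a..b}\<close>, so they are one-sided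
  at the endpoints.
\<close>

definition nderiv :: "real set \<Rightarrow> nat \<Rightarrow> (real \<Rightarrow> real) \<Rightarrow> real \<Rightarrow> real" where
  "nderiv I k = ((\<lambda>u t. vector_derivative u (at t within I)) ^^ k)"

definition Cn_on :: "real set \<Rightarrow> nat \<Rightarrow> (real \<Rightarrow> real) \<Rightarrow> bool" where
  "Cn_on I n u \<longleftrightarrow>
     (\<forall>k<n. \<forall>t\<in>I. nderiv I k u differentiable (at t within I)) \<and>
     (\<forall>k\<le>n. continuous_on I (nderiv I k u))"

definition T_op :: "real \<Rightarrow> real \<Rightarrow> nat \<Rightarrow> (nat \<Rightarrow> real \<Rightarrow> real) \<Rightarrow> real
    \<Rightarrow> (real \<Rightarrow> real) \<Rightarrow> real \<Rightarrow> real" where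
  "T_op a b n p M u t =
     nderiv {a..b} n u t + (\<Sum>k=1..n. p k t * nderiv {a..b} (n - k) u t) + M * u t"

definition bdry :: "real \<Rightarrow> real \<Rightarrow> nat \<Rightarrow> (nat \<Rightarrow> nat \<Rightarrow> real) \<Rightarrow> (nat \<Rightarrow> nat \<Rightarrow> real)
    \<Rightarrow> nat \<Rightarrow> (real \<Rightarrow> real) \<Rightarrow> real" where
  "bdry a b n \<alpha> \<beta> i u =
     (\<Sum>j<n. \<alpha> i j * nderiv {a..b} j u a + \<beta> i j * nderiv {a..b} j u b)"

definition solves_bvp :: "real \<Rightarrow> real \<Rightarrow> nat \<Rightarrow> (nat \<Rightarrow> real \<Rightarrow> real) \<Rightarrow> real
    \<Rightarrow> (nat \<Rightarrow> nat \<Rightarrow> real) \<Rightarrow> (nat \<Rightarrow> nat \<Rightarrow> real)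
    \<Rightarrow> (real \<Rightarrow> real) \<Rightarrow> (nat \<Rightarrow> real) \<Rightarrow> (real \<Rightarrow> real) \<Rightarrow> bool" where
  "solves_bvp a b n p M \<alpha> \<beta> \<sigma> c u \<longleftrightarrow>
     Cn_on {a..b} n u \<and>
     (\<forall>t\<in>{a..b}. T_op a b n p M u t = \<sigma> t) \<and>
     (\<forall>i\<in>{1..n}. bdry a b n \<alpha> \<beta> i u = c i)"

definition lower_tri :: "real \<Rightarrow> real \<Rightarrow> (real \<times> real) set" where
  "lower_tri a b = {(t, s). a \<le> s \<and> s < t \<and> t \<le> b}"

definition upper_tri :: "real \<Rightarrow> real \<Rightarrow> (real \<times> real) set" where
  "upper_tri a b = {(t, s). a \<le> t \<and> t < s \<and> s \<le> b}"

definition closed_lower_tri :: "real \<Rightarrow> real \<Rightarrow> (real \<times> real) set" where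
  "closed_lower_tri a b = {(t, s). a \<le> s \<and> s \<le> t \<and> t \<le> b}"

definition closed_upper_tri :: "real \<Rightarrow> real \<Rightarrow> (real \<times> real) set" where
  "closed_upper_tri a b = {(t, s). a \<le> t \<and> t \<le> s \<and> s \<le> b}"

definition dt :: "real \<Rightarrow> real \<Rightarrow> nat \<Rightarrow> (real \<Rightarrow> real \<Rightarrow> real) \<Rightarrow> real \<Rightarrow> real \<Rightarrow> real" where
  "dt a b k g t s = nderiv {a..b} k (\<lambda>r. g r s) t"

text \<open>
  Off the diagonal, \<^term>\<open>dt a b k g t s\<close> only depends on \<open>g (\<cdot>, s)\<close> near \<open>t\<close>, so it is the
  derivative within the triangle containing \<open>(t, s)\<close>.
\<close>

definition regular_on_tri :: "real \<Rightarrow> real \<Rightarrow> nat \<Rightarrow> (nat \<Rightarrow> real \<Rightarrow> real) \<Rightarrow> real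
    \<Rightarrow> (real \<times> real) set \<Rightarrow> (real \<times> real) set \<Rightarrow> (real \<Rightarrow> real \<Rightarrow> real) \<Rightarrow> bool" where
  "regular_on_tri a b n p M \<Delta> \<Delta>c g \<longleftrightarrow>
     (\<forall>k<n. \<forall>(t, s)\<in>\<Delta>. (\<lambda>r. dt a b k g r s) differentiable (at t within {a..b})) \<and>
     (\<forall>k\<le>n. continuous_on \<Delta> (\<lambda>(t, s). dt a b k g t s)) \<and>
     (\<forall>k\<le>n. \<exists>h. continuous_on \<Delta>c h \<and> (\<forall>(t, s)\<in>\<Delta>. h (t, s) = dt a b k g t s)) \<and>
     (\<forall>(t, s)\<in>\<Delta>. T_op a b n p M (\<lambda>r. g r s) t = 0)"

text \<open>
  For \<open>n = 1\<close> the last clause fixes the values on the diagonal, where the kernel jumps: they are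
  the continuous extension from one of the two triangles.
\<close>

definition is_green_function :: "real \<Rightarrow> real \<Rightarrow> nat \<Rightarrow> (nat \<Rightarrow> real \<Rightarrow> real) \<Rightarrow> real
    \<Rightarrow> (nat \<Rightarrow> nat \<Rightarrow> real) \<Rightarrow> (nat \<Rightarrow> nat \<Rightarrow> real) \<Rightarrow> (real \<Rightarrow> real \<Rightarrow> real) \<Rightarrow> bool" where
  "is_green_function a b n p M \<alpha> \<beta> g \<longleftrightarrow>
     (\<forall>k. k + 2 < n \<longrightarrow>
        (\<forall>t\<in>{a..b}. \<forall>s\<in>{a..b}. (\<lambda>r. dt a b k g r s) differentiable (at t within {a..b}))) \<and>
     (\<forall>k. k + 2 \<le> n \<longrightarrow> continuous_on ({a..b} \<times> {a..b}) (\<lambda>(t, s). dt a b k g t s)) \<and>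
     regular_on_tri a b n p M (lower_tri a b) (closed_lower_tri a b) g \<and>
     regular_on_tri a b n p M (upper_tri a b) (closed_upper_tri a b) g \<and>
     (\<forall>s\<in>{a<..<b}. \<exists>l r.
        ((\<lambda>t. dt a b (n - 1) g t s) \<longlongrightarrow> r) (at_right s) \<and>
        ((\<lambda>t. dt a b (n - 1) g t s) \<longlongrightarrow> l) (at_left s) \<and> r - l = 1) \<and>
     (\<forall>s\<in>{a<..<b}. \<forall>i\<in>{1..n}. bdry a b n \<alpha> \<beta> i (\<lambda>t. g t s) = 0) \<and>
     (n = 1 \<longrightarrow>
        continuous_on (closed_lower_tri a b) (\<lambda>(t, s). g t s) \<or>
        continuous_on (closed_upper_tri a b) (\<lambda>(t, s). g t s))"

definition supnorm :: "real \<Rightarrow> real \<Rightarrow> (real \<Rightarrow> real) \<Rightarrow> real" where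
  "supnorm a b u = (SUP t\<in>{a..b}. \<bar>u t\<bar>)"

text \<open>
  Linearity and continuity force \<open>C u\<close> to depend only on the restriction of \<open>u\<close> to \<open>{a..b}\<close>;
  the values of \<open>C\<close> on functions that are not continuous on \<open>{a..b}\<close> are irrelevant.
\<close>

definition continuous_linear_functional :: "real \<Rightarrow> real \<Rightarrow> ((real \<Rightarrow> real) \<Rightarrow> real) \<Rightarrow> bool" where
  "continuous_linear_functional a b C \<longleftrightarrow>
     (\<forall>u v. continuous_on {a..b} u \<longrightarrow> continuous_on {a..b} v \<longrightarrow>
        C (\<lambda>t. u t + v t) = C u + C v) \<and>
     (\<forall>c u. continuous_on {a..b} u \<longrightarrow> C (\<lambda>t. c * u t) = c * C u) \<and>
     (\<forall>u. continuous_on {a..b} u \<longrightarrow>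
        (\<forall>\<epsilon>>0. \<exists>\<eta>>0. \<forall>v. continuous_on {a..b} v \<longrightarrow>
           supnorm a b (\<lambda>t. v t - u t) < \<eta> \<longrightarrow> \<bar>C v - C u\<bar> < \<epsilon>))"

text \<open>
  The finite signed Borel measure \<open>\<mu> - \<nu>\<close> on \<open>[a,b]\<close> represents \<open>C\<close> in the sense of the Riesz
  theorem. The pair \<open>(\<mu>, \<nu>)\<close> is not unique, but the signed measure is.
\<close>

definition riesz_represents :: "real \<Rightarrow> real \<Rightarrow> ((real \<Rightarrow> real) \<Rightarrow> real)
    \<Rightarrow> real measure \<Rightarrow> real measure \<Rightarrow> bool" where
  "riesz_represents a b C \<mu> \<nu> \<longleftrightarrow>
     finite_measure \<mu> \<and> sets \<mu> = sets (restrict_space borel {a..b}) \<and>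
     finite_measure \<nu> \<and> sets \<nu> = sets (restrict_space borel {a..b}) \<and>
     (\<forall>u. continuous_on {a..b} u \<longrightarrow>
        C u = (\<integral>t. u t \<partial>\<mu>) - (\<integral>t. u t \<partial>\<nu>))"

text \<open>
  The extension of \<open>C\<close> to bounded Borel functions, needed for \<open>g (\<cdot>, s)\<close> when \<open>n = 1\<close>.
\<close>

definition C_ext :: "real \<Rightarrow> real \<Rightarrow> ((real \<Rightarrow> real) \<Rightarrow> real) \<Rightarrow> (real \<Rightarrow> real) \<Rightarrow> real" where
  "C_ext a b C f =
     (if continuous_on {a..b} f then C f
      else THE x. \<exists>\<mu> \<nu>. riesz_represents a b C \<mu> \<nu> \<and> x = (\<integral>t. f t \<partial>\<mu>) - (\<integral>t. f t \<partial>\<nu>))"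

definition nonlocal_green :: "real \<Rightarrow> real \<Rightarrow> nat \<Rightarrow> ((real \<Rightarrow> real) \<Rightarrow> real) \<Rightarrow> (nat \<Rightarrow> real)
    \<Rightarrow> (nat \<Rightarrow> real \<Rightarrow> real) \<Rightarrow> (real \<Rightarrow> real \<Rightarrow> real) \<Rightarrow> real \<Rightarrow> real \<Rightarrow> real" where
  "nonlocal_green a b n C \<delta> \<omega> g t s =
     g t s + (\<Sum>i=1..n. \<delta> i * \<omega> i t) / (1 - (\<Sum>j=1..n. \<delta> j * C (\<omega> j)))
       * C_ext a b C (\<lambda>r. g r s)"

end

theory Submission
  imports Defs "HOL-Probability.Helly_Selection"
begin

text \<open>
  The correction term is \<open>C (g (\<cdot>, s))\<close> times a non-negative factor, so it suffices that the
  extension of \<open>C\<close> to the slice \<open>g (\<cdot>, s)\<close> is a positive functional. Such a slice is bounded and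
  continuous off \<open>s\<close>, hence a bounded pointwise limit of continuous functions of the same sign, and
  by dominated convergence every measure representing \<open>C\<close> integrates it to the limit of the values
  of \<open>C\<close>. A representing measure exists: \<open>C\<close> of the Bernstein basis polynomials gives weights at the
  nodes, and by Helly selection the resulting discrete measures have a weakly convergent
  subsequence, whose limit represents \<open>C\<close> because Bernstein polynomials converge uniformly.
\<close>

section \<open>Linearity of the functional on continuous functions\<close>

lemma clf_add:
  assumes "continuous_linear_functional a b C" "continuous_on {a..b} u" "continuous_on {a..b} v"
  shows "C (\<lambda>t. u t + v t) = C u + C v"
  using assms unfolding continuous_linear_functional_def by blast

lemma clf_cmult:
  assumes "continuous_linear_functional a b C" "continuous_on {a..b} u"
  shows "C (\<lambda>t. c * u t) = c * C u"
  using assms unfolding continuous_linear_functional_def by blast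

lemma clf_zero:
  assumes "continuous_linear_functional a b C"
  shows "C (\<lambda>_. 0) = 0"
  using clf_cmult[OF assms, of "\<lambda>_. 0" 0] by simp

lemma clf_const:
  assumes "continuous_linear_functional a b C"
  shows "C (\<lambda>_. c) = c * C (\<lambda>_. 1)"
  using clf_cmult[OF assms, of "\<lambda>_. 1" c] by simp

lemma clf_uminus:
  assumes "continuous_linear_functional a b C" "continuous_on {a..b} u"
  shows "C (\<lambda>t. - u t) = - C u"
  using clf_cmult[OF assms, of "-1"] by simp

lemma clf_diff:
  assumes "continuous_linear_functional a b C" "continuous_on {a..b} u" "continuous_on {a..b} v"
  shows "C (\<lambda>t. u t - v t) = C u - C v"
  using clf_add[OF assms(1,2), of "\<lambda>t. - v t"] clf_uminus[OF assms(1,3)] assms(3)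
  by (simp add: continuous_on_minus)

lemma clf_sum:
  assumes "continuous_linear_functional a b C" "finite A"
    and "\<And>k. k \<in> A \<Longrightarrow> continuous_on {a..b} (u k)"
  shows "C (\<lambda>t. \<Sum>k\<in>A. c k * u k t) = (\<Sum>k\<in>A. c k * C (u k))"
  using assms(2,3)
proof (induction A rule: finite_induct)
  case empty
  show ?case using clf_zero[OF assms(1)] by simp
next
  case (insert k A)
  then have "C (\<lambda>t. c k * u k t + (\<Sum>j\<in>A. c j * u j t)) = C (\<lambda>t. c k * u k t) + C (\<lambda>t. \<Sum>j\<in>A. c j * u j t)"
    by (intro clf_add[OF assms(1)] continuous_intros) auto
  with insert show ?case
    by (simp add: clf_cmult[OF assms(1)])
qed

section \<open>Positive functionals and Bernstein quadrature\<close>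

locale positive_functional =
  fixes a b :: real and C :: "(real \<Rightarrow> real) \<Rightarrow> real"
  assumes less: "a < b"
    and clf: "continuous_linear_functional a b C"
    and nonneg: "\<And>u. continuous_on {a..b} u \<Longrightarrow> (\<And>t. t \<in> {a..b} \<Longrightarrow> 0 \<le> u t) \<Longrightarrow> 0 \<le> C u"
begin

text \<open>Positivity applied to \<open>e - (u - v)\<close> and \<open>e + (u - v)\<close> traps
  \<open>C u - C v\<close> between \<open>-e * C 1\<close> and \<open>e * C 1\<close>. This
  quantitative continuity, with constant \<open>C 1\<close>, drives all later estimates.\<close>

lemma abs_diff_le:
  assumes u: "continuous_on {a..b} u" and v: "continuous_on {a..b} v"
    and le: "\<And>t. t \<in> {a..b} \<Longrightarrow> \<bar>u t - v t\<bar> \<le> e"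
  shows "\<bar>C u - C v\<bar> \<le> e * C (\<lambda>_. 1)"
proof -
  have d: "continuous_on {a..b} (\<lambda>t. u t - v t)"
    by (intro continuous_intros u v)
  have "0 \<le> C (\<lambda>t. e - (u t - v t))"
    using le by (intro nonneg continuous_intros u v) (smt (verit))
  moreover have "0 \<le> C (\<lambda>t. e + (u t - v t))"
    using le by (intro nonneg continuous_intros u v) (smt (verit))
  ultimately show ?thesis
    using clf_diff[OF clf continuous_on_const d, of e] clf_add[OF clf continuous_on_const d, of e]
      clf_diff[OF clf u v] clf_const[OF clf, of e]
    by simp
qed

text \<open>The Bernstein nodes \<open>k / m\<close> of \<open>[0,1]\<close>, moved to
  \<open>[a,b]\<close>. For \<open>m = 0\<close> the quotient is 0 by convention, so the only node
  is \<open>a\<close> and no positivity of \<open>m\<close> is required later.\<close>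

definition node :: "nat \<Rightarrow> nat \<Rightarrow> real" where
  "node m k = a + (b - a) * (k / m)"

definition weight :: "nat \<Rightarrow> nat \<Rightarrow> real" where
  "weight m k = C (\<lambda>t. Bernstein m k ((t - a) / (b - a)))"

lemma node_in: "k \<le> m \<Longrightarrow> node m k \<in> {a..b}"
proof -
  assume "k \<le> m"
  then have "0 \<le> real k / real m" "real k / real m \<le> 1"
    by (auto simp: divide_le_eq_1)
  then show ?thesis
    using less mult_left_le[of "real k / real m" "b - a"] by (auto simp: node_def)
qed

lemma continuous_Bernstein: "continuous_on {a..b} (\<lambda>t. Bernstein m k ((t - a) / (b - a)))"
  unfolding Bernstein_def using less by (intro continuous_intros) auto

lemma weight_nonneg: "0 \<le> weight m k"
  unfolding weight_def using less
  by (intro nonneg continuous_Bernstein Bernstein_nonneg) (auto simp: field_simps)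

lemma Bernstein_functional:
  "C (\<lambda>t. \<Sum>k\<le>m. c k * Bernstein m k ((t - a) / (b - a))) = (\<Sum>k\<le>m. c k * weight m k)"
  unfolding weight_def by (intro clf_sum[OF clf] continuous_Bernstein) auto

lemma sum_weight: "(\<Sum>k\<le>m. weight m k) = C (\<lambda>_. 1)"
  using Bernstein_functional[where m = m and c = "\<lambda>_. 1"] by simp

text \<open>By linearity the sum is \<open>C\<close> of the Bernstein polynomial of \<open>u\<close>
  rescaled to \<open>[a,b]\<close>. These polynomials converge uniformly to \<open>u\<close>, and
  \<open>abs_diff_le\<close> carries the convergence over to \<open>C\<close>.\<close>

lemma Bernstein_quadrature:
  assumes u: "continuous_on {a..b} u"
  shows "(\<lambda>m. \<Sum>k\<le>m. u (node m k) * weight m k) \<longlonglongrightarrow> C u"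
proof (rule LIMSEQ_I)
  fix r :: real assume "0 < r"
  have C1: "0 \<le> C (\<lambda>_. 1)"
    by (rule nonneg) auto
  \<comment> \<open>Adding 1 keeps the denominator positive even if \<open>C 1 = 0\<close>, and
    makes \<open>e * C 1 < r\<close> strict.\<close>
  define e where "e = r / (C (\<lambda>_. 1) + 1)"
  have "0 < e" and er: "e * C (\<lambda>_. 1) < r"
    using \<open>0 < r\<close> C1 by (auto simp: e_def field_simps)
  have "a + (b - a) * x \<in> {a..b}" if "x \<in> {0..1}" for x
  proof -
    have "(b - a) * x \<le> b - a"
      using less that by (intro mult_left_le) auto
    then have "a + (b - a) * x \<le> b"
      by linarith
    then show ?thesis
      using less that by simp
  qed
  then have "continuous_on {0..1} (\<lambda>x. u (a + (b - a) * x))"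
    by (intro continuous_on_compose2[OF u] continuous_intros) auto
  from Bernstein_Weierstrass[OF this \<open>0 < e\<close>] obtain N where
    N: "\<And>m x. N \<le> m \<Longrightarrow> x \<in> {0..1} \<Longrightarrow>
          \<bar>u (a + (b - a) * x) - (\<Sum>k\<le>m. u (node m k) * Bernstein m k x)\<bar> < e"
    unfolding node_def by blast
  have "norm ((\<Sum>k\<le>m. u (node m k) * weight m k) - C u) < r" if "N \<le> m" for m
  proof -
    have "\<bar>C u - C (\<lambda>t. \<Sum>k\<le>m. u (node m k) * Bernstein m k ((t - a) / (b - a)))\<bar> \<le> e * C (\<lambda>_. 1)"
    proof (intro abs_diff_le u continuous_intros continuous_Bernstein)
      fix t assume "t \<in> {a..b}"
      then have "(t - a) / (b - a) \<in> {0..1}"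
        using less by auto
      from N[OF that this] show
        "\<bar>u t - (\<Sum>k\<le>m. u (node m k) * Bernstein m k ((t - a) / (b - a)))\<bar> \<le> e"
        using less by simp
    qed
    then show ?thesis
      using er unfolding Bernstein_functional by (simp add: abs_minus_commute)
  qed
  then show "\<exists>N. \<forall>m\<ge>N. norm ((\<Sum>k\<le>m. u (node m k) * weight m k) - C u) < r"
    by blast
qed

section \<open>Riesz representation by Helly selection\<close>

text \<open>The retraction of the line onto \<open>[a,b]\<close>. Helly selection lives on the whole
  line: composing with \<open>clamp1\<close> extends a continuous \<open>u\<close> to a bounded
  continuous function there, and pushing forward along it brings a measure back to
  \<open>[a,b]\<close>.\<close>

definition clamp1 :: "real \<Rightarrow> real" where
  "clamp1 x = max a (min b x)"

lemma clamp1_in: "clamp1 x \<in> {a..b}"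
  using less by (auto simp: clamp1_def)

lemma clamp1_id: "x \<in> {a..b} \<Longrightarrow> clamp1 x = x"
  by (auto simp: clamp1_def)

lemma clamp1_measurable: "clamp1 \<in> measurable borel (restrict_space borel {a..b})"
  by (rule measurable_restrict_space2)
    (use clamp1_in in \<open>auto simp: clamp1_def[abs_def]\<close>)

text \<open>Dividing the weights by \<open>C 1\<close> makes them sum to 1, so the discrete measures
  at the nodes are probability distributions. All of them live on \<open>[a,b]\<close>, hence they
  are tight, and a weak subsequential limit integrates \<open>u\<close> to the limit of the
  quadrature sums.\<close>

lemma normalized_representation:
  assumes pos: "0 < C (\<lambda>_. 1)"
  shows "\<exists>M. real_distribution M \<and>
    (\<forall>u. continuous_on {a..b} u \<longrightarrow> C u = C (\<lambda>_. 1) * (\<integral>x. u (clamp1 x) \<partial>M))"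
proof -
  let ?c = "C (\<lambda>_. 1)"
  define P where "P m = point_measure {..m} (\<lambda>k. weight m k / ?c)" for m
  define Q where "Q m = distr (P m) borel (node m)" for m
  have P: "prob_space (P m)" for m
    unfolding P_def using pos weight_nonneg sum_weight
    by (intro prob_space_point_measure) (auto simp flip: sum_divide_distrib)
  have meas: "node m \<in> measurable (P m) borel" for m
    by (auto simp: measurable_def P_def space_point_measure sets_point_measure)
  have Q: "real_distribution (Q m)" for m
    unfolding real_distribution_def real_distribution_axioms_def Q_def
    using prob_space.prob_space_distr[OF P meas] by simp
  have intQ: "(\<integral>x. f x \<partial>Q m) = (\<Sum>k\<le>m. f (node m k) * weight m k) / ?c"
    if "f \<in> borel_measurable borel" for f :: "real \<Rightarrow> real" and m
  proof -
    have "(\<integral>x. f x \<partial>Q m) = (\<integral>k. f (node m k) \<partial>P m)"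
      unfolding Q_def by (rule integral_distr[OF meas that])
    also have "\<dots> = (\<Sum>k\<le>m. (weight m k / ?c) *\<^sub>R f (node m k))"
      unfolding P_def using pos weight_nonneg
      by (intro lebesgue_integral_point_measure_finite) auto
    finally show ?thesis
      by (simp add: sum_divide_distrib mult.commute)
  qed
  \<comment> \<open>Tightness is phrased with intervals open on the left; starting at
    \<open>a - 1\<close> keeps the node \<open>a\<close> inside.\<close>
  have "measure (Q m) {a - 1<..b} = 1" for m
  proof -
    have "node m -` {a - 1<..b} \<inter> space (P m) = space (P m)"
      using node_in[of _ m] by (force simp: P_def space_point_measure)
    then show ?thesis
      unfolding Q_def using prob_space.prob_space[OF P[of m]] by (subst measure_distr[OF meas]) auto
  qed
  moreover have "a - 1 < b"
    using less by simp
  ultimately have "tight Q"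
    unfolding tight_def using Q by (metis diff_less_eq less_add_same_cancel1)
  from tight_imp_convergent_subsubsequence[OF this strict_mono_id] obtain r M where
    r: "strict_mono r" and M: "real_distribution M" and conv: "weak_conv_m (Q \<circ> r) M"
    by auto
  have "C u = ?c * (\<integral>x. u (clamp1 x) \<partial>M)" if u: "continuous_on {a..b} u" for u
  proof -
    have cont: "continuous_on UNIV (\<lambda>x. u (clamp1 x))"
      by (rule continuous_on_compose2[OF u])
        (use clamp1_in in \<open>auto simp: clamp1_def[abs_def] intro!: continuous_intros\<close>)
    obtain B where B: "\<And>t. t \<in> {a..b} \<Longrightarrow> norm (u t) \<le> B"
      using compact_imp_bounded[OF compact_continuous_image[OF u compact_Icc]]
      unfolding bounded_iff by blast
    \<comment> \<open>Weak convergence may be tested against \<open>u\<close> composed with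
      \<open>clamp1\<close>, which is bounded and continuous on the line. At the nodes the clamp is
      invisible, so the integrals are the quadrature sums.\<close>
    have "(\<lambda>m. \<integral>x. u (clamp1 x) \<partial>(Q \<circ> r) m) \<longlonglongrightarrow> (\<integral>x. u (clamp1 x) \<partial>M)"
      by (rule weak_conv_imp_integral_bdd_continuous_conv[OF _ M conv, where B = B])
        (use Q cont B clamp1_in in \<open>auto simp: continuous_on_eq_continuous_at\<close>)
    moreover have "(\<integral>x. u (clamp1 x) \<partial>(Q \<circ> r) m) = (\<Sum>k\<le>r m. u (node (r m) k) * weight (r m) k) / ?c" for m
      using intQ[OF borel_measurable_continuous_onI[OF cont], of "r m"]
      by (simp add: clamp1_id[OF node_in])
    moreover have "(\<lambda>m. (\<Sum>k\<le>r m. u (node (r m) k) * weight (r m) k) / ?c) \<longlonglongrightarrow> C u / ?c"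
      using LIMSEQ_subseq_LIMSEQ[OF Bernstein_quadrature[OF u] r] pos
      by (intro tendsto_divide) (auto simp: o_def)
    ultimately have "(\<integral>x. u (clamp1 x) \<partial>M) = C u / ?c"
      using LIMSEQ_unique by fastforce
    then show ?thesis using pos by simp
  qed
  with M show ?thesis by blast
qed

text \<open>A positive functional can be represented with zero negative part. Normalization requires
  \<open>C 1 > 0\<close>, so the case \<open>C 1 = 0\<close>, in which \<open>C\<close> vanishes on
  continuous functions, is treated apart.\<close>

theorem Riesz_representation:
  "\<exists>\<mu>. riesz_represents a b C \<mu> (null_measure (restrict_space borel {a..b}))"
proof (cases "C (\<lambda>_. 1) = 0")
  case True
  \<comment> \<open>Comparing \<open>u\<close> with 0 in \<open>abs_diff_le\<close> bounds
    \<open>C u\<close> by a multiple of \<open>C 1\<close>, which is 0.\<close>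
  have "C u = 0" if u: "continuous_on {a..b} u" for u
  proof -
    obtain B where "\<And>t. t \<in> {a..b} \<Longrightarrow> norm (u t) \<le> B"
      using compact_imp_bounded[OF compact_continuous_image[OF u compact_Icc]]
      unfolding bounded_iff by blast
    then show ?thesis
      using abs_diff_le[OF u continuous_on_const, of 0 B] True clf_zero[OF clf] by auto
  qed
  then show ?thesis
    by (auto simp: riesz_represents_def intro!: exI[of _ "null_measure (restrict_space borel {a..b})"]
        finite_measureI)
next
  case False
  let ?c = "C (\<lambda>_. 1)"
  have "0 \<le> ?c"
    by (rule nonneg) auto
  with False have pos: "0 < ?c" by simp
  from normalized_representation[OF pos] obtain M where M: "real_distribution M"
    and rep: "\<And>u. continuous_on {a..b} u \<Longrightarrow> C u = ?c * (\<integral>x. u (clamp1 x) \<partial>M)"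
    by blast
  interpret real_distribution M by fact
  \<comment> \<open>The constant density undoes the normalization and restores the total mass
    \<open>C 1\<close>.\<close>
  let ?D = "density M (\<lambda>_. ?c)"
  have meas: "clamp1 \<in> measurable ?D (restrict_space borel {a..b})"
    using clamp1_measurable by simp
  define \<mu> where "\<mu> = distr ?D (restrict_space borel {a..b}) clamp1"
  have "finite_measure ?D"
    using emeasure_space_1
    by (intro finite_measureI) (auto simp: emeasure_density nn_integral_cmult ennreal_mult_eq_top_iff)
  then have "finite_measure \<mu>"
    unfolding \<mu>_def by (rule finite_measure.finite_measure_distr[OF _ meas])
  moreover have "C u = (\<integral>t. u t \<partial>\<mu>)" if u: "continuous_on {a..b} u" for u
  proof -
    have um: "u \<in> borel_measurable (restrict_space borel {a..b})"
      by (rule borel_measurable_continuous_on_restrict[OF u])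
    have "(\<integral>t. u t \<partial>\<mu>) = (\<integral>x. u (clamp1 x) \<partial>?D)"
      unfolding \<mu>_def by (rule integral_distr[OF meas um])
    also have "\<dots> = (\<integral>x. ?c *\<^sub>R u (clamp1 x) \<partial>M)"
      using pos measurable_compose[OF clamp1_measurable um]
      by (intro integral_density) auto
    finally show ?thesis
      using rep[OF u] by simp
  qed
  moreover have "sets \<mu> = sets (restrict_space borel {a..b})"
    by (simp add: \<mu>_def)
  moreover have "finite_measure (null_measure (restrict_space borel {a..b}))"
    by (rule finite_measureI) simp
  ultimately have "riesz_represents a b C \<mu> (null_measure (restrict_space borel {a..b}))"
    by (simp add: riesz_represents_def)
  then show ?thesis ..
qed

end

section \<open>Continuous approximation of functions with one discontinuity\<close>

text \<open>
  A bounded function whose only discontinuity on \<open>{a..b}\<close> is at \<open>s\<close> is the pointwise limit of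
  these continuous functions.
\<close>

definition tent_approx :: "(real \<Rightarrow> real) \<Rightarrow> real \<Rightarrow> nat \<Rightarrow> real \<Rightarrow> real" where
  "tent_approx f s k t = f t * min 1 (k * \<bar>t - s\<bar>) + f s * max 0 (1 - k * \<bar>t - s\<bar>)"

text \<open>Each of the two summands is at most \<open>B\<close> in absolute value. A bound
  independent of \<open>k\<close> is what dominated convergence asks for.\<close>

lemma tent_approx_bound:
  assumes "\<bar>f t\<bar> \<le> B" "\<bar>f s\<bar> \<le> B"
  shows "\<bar>tent_approx f s k t\<bar> \<le> 2 * B"
proof -
  have "\<bar>f t * min 1 (k * \<bar>t - s\<bar>)\<bar> \<le> B * 1"
    unfolding abs_mult using assms(1) by (intro mult_mono) auto
  moreover have "\<bar>f s * max 0 (1 - k * \<bar>t - s\<bar>)\<bar> \<le> B * 1"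
    unfolding abs_mult using assms(2) by (intro mult_mono) auto
  ultimately show ?thesis
    unfolding tent_approx_def mult_2 mult_1_right by (rule order_trans[OF abs_triangle_ineq add_mono])
qed

lemma tent_approx_nonneg:
  assumes "0 \<le> f t" "0 \<le> f s"
  shows "0 \<le> tent_approx f s k t"
  unfolding tent_approx_def using assms by simp

lemma tent_approx_uminus: "tent_approx (\<lambda>t. - f t) s k t = - tent_approx f s k t"
  by (simp add: tent_approx_def)

text \<open>At \<open>s\<close> the sequence is constantly \<open>f s\<close>. Elsewhere it equals
  \<open>f t\<close> as soon as \<open>k * \<bar>t - s\<bar>\<close> exceeds 1.\<close>

lemma tent_approx_tendsto: "(\<lambda>k. tent_approx f s k t) \<longlonglongrightarrow> f t"
proof (cases "t = s")
  case True
  then show ?thesis by (simp add: tent_approx_def)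
next
  case False
  then obtain N where N: "1 < real N * \<bar>t - s\<bar>"
    using reals_Archimedean3[of "\<bar>t - s\<bar>"] by auto
  have "tent_approx f s k t = f t" if "N \<le> k" for k
  proof -
    have "real N * \<bar>t - s\<bar> \<le> real k * \<bar>t - s\<bar>"
      using that by (intro mult_right_mono) auto
    with N show ?thesis by (simp add: tent_approx_def)
  qed
  then show ?thesis
    by (intro tendsto_eventually eventually_sequentiallyI)
qed

text \<open>The cut-off factor vanishes at \<open>s\<close>, so boundedness of \<open>f\<close>
  squeezes the first summand to 0 there, whatever \<open>f\<close> does near \<open>s\<close>. The
  second summand is a multiple of a continuous tent.\<close>

lemma continuous_on_tent_approx:
  assumes f: "continuous_on (A - {s}) f" and B: "\<And>t. t \<in> A \<Longrightarrow> \<bar>f t\<bar> \<le> B"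
  shows "continuous_on A (tent_approx f s k)"
proof -
  have "continuous_on A (\<lambda>t. f t * min 1 (k * \<bar>t - s\<bar>))"
    unfolding continuous_on_eq_continuous_within
  proof
    fix t assume t: "t \<in> A"
    show "continuous (at t within A) (\<lambda>t. f t * min 1 (k * \<bar>t - s\<bar>))"
    proof (cases "t = s")
      case False
      then have "continuous (at t within A - {s}) f"
        using f t by (auto simp: continuous_on_eq_continuous_within)
      \<comment> \<open>The complement of \<open>s\<close> is an open neighbourhood of
        \<open>t\<close>, so removing \<open>s\<close> does not change limits at
        \<open>t\<close>.\<close>
      moreover have "at t within A - {s} = at t within A"
        using False by (intro at_within_nhd[of _ "- {s}"]) auto
      ultimately show ?thesis
        by (auto intro!: continuous_intros)
    next
      case True
      have "((\<lambda>t. f t * min 1 (k * \<bar>t - s\<bar>)) \<longlongrightarrow> 0) (at s within A)"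
      proof (rule Lim_null_comparison)
        show "((\<lambda>t. B * (k * \<bar>t - s\<bar>)) \<longlongrightarrow> 0) (at s within A)"
          by (auto intro!: tendsto_eq_intros)
        show "\<forall>\<^sub>F t in at s within A. norm (f t * min 1 (k * \<bar>t - s\<bar>)) \<le> B * (k * \<bar>t - s\<bar>)"
          unfolding eventually_at_filter
        proof (intro always_eventually allI impI)
          fix t assume "t \<in> A"
          have "\<bar>f t\<bar> * \<bar>min 1 (k * \<bar>t - s\<bar>)\<bar> \<le> B * (k * \<bar>t - s\<bar>)"
            using B[OF \<open>t \<in> A\<close>] by (intro mult_mono) auto
          then show "norm (f t * min 1 (k * \<bar>t - s\<bar>)) \<le> B * (k * \<bar>t - s\<bar>)"
            by (simp add: abs_mult)
        qed
      qed
      then show ?thesis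
        using True by (simp add: continuous_within)
    qed
  qed
  then show ?thesis
    unfolding tent_approx_def[abs_def] by (rule continuous_on_add) (intro continuous_intros)
qed

text \<open>Dominated convergence for each of the two measures. The sequence on the left involves
  only \<open>C\<close>, so every representing pair must give the same value on the right.\<close>

lemma riesz_represents_limit:
  assumes rep: "riesz_represents a b C \<mu> \<nu>"
    and f: "continuous_on ({a..b} - {s}) f" and s: "s \<in> {a..b}"
    and B: "\<And>t. t \<in> {a..b} \<Longrightarrow> \<bar>f t\<bar> \<le> B"
  shows "(\<lambda>k. C (tent_approx f s k)) \<longlonglongrightarrow> (\<integral>t. f t \<partial>\<mu>) - (\<integral>t. f t \<partial>\<nu>)"
proof -
  note cont = continuous_on_tent_approx[OF f B]
  have conv: "(\<lambda>k. \<integral>t. tent_approx f s k t \<partial>m) \<longlonglongrightarrow> (\<integral>t. f t \<partial>m)"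
    if fin: "finite_measure m" and sets: "sets m = sets (restrict_space borel {a..b})"
    for m :: "real measure"
  proof (rule integral_dominated_convergence[where w = "\<lambda>_. 2 * B"])
    have space: "space m = {a..b}"
      using sets_eq_imp_space_eq[OF sets] by (simp add: space_restrict_space)
    show approx: "tent_approx f s k \<in> borel_measurable m" for k
      using borel_measurable_continuous_on_restrict[OF cont] sets
      by (simp cong: measurable_cong_sets)
    \<comment> \<open>Measurability of \<open>f\<close> comes for free as that of a pointwise limit
      of continuous functions.\<close>
    show "f \<in> borel_measurable m"
      by (rule borel_measurable_LIMSEQ_metric[OF approx tent_approx_tendsto])
    show "integrable m (\<lambda>_. 2 * B)"
      using finite_measure.integrable_const[OF fin] .
    show "AE t in m. (\<lambda>k. tent_approx f s k t) \<longlonglongrightarrow> f t"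
      by (simp add: tent_approx_tendsto)
    show "AE t in m. norm (tent_approx f s k t) \<le> 2 * B" for k
      by (rule AE_I2) (use tent_approx_bound B s space in auto)
  qed
  have "C (tent_approx f s k) = (\<integral>t. tent_approx f s k t \<partial>\<mu>) - (\<integral>t. tent_approx f s k t \<partial>\<nu>)" for k
    using rep cont by (auto simp: riesz_represents_def)
  moreover have "(\<lambda>k. (\<integral>t. tent_approx f s k t \<partial>\<mu>) - (\<integral>t. tent_approx f s k t \<partial>\<nu>))
      \<longlonglongrightarrow> (\<integral>t. f t \<partial>\<mu>) - (\<integral>t. f t \<partial>\<nu>)"
    using rep by (intro tendsto_diff conv) (auto simp: riesz_represents_def)
  ultimately show ?thesis by simp
qed

section \<open>Positivity of the extended functional\<close>

context positive_functional
begin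

text \<open>
  The limit does not depend on the representing pair, which makes the \<open>THE\<close> in the definition of
  \<^const>\<open>C_ext\<close> well defined.
\<close>

lemma C_ext_limit:
  assumes f: "continuous_on ({a..b} - {s}) f" "\<not> continuous_on {a..b} f" and s: "s \<in> {a..b}"
    and B: "\<And>t. t \<in> {a..b} \<Longrightarrow> \<bar>f t\<bar> \<le> B"
  shows "(\<lambda>k. C (tent_approx f s k)) \<longlonglongrightarrow> C_ext a b C f"
proof -
  note lim = riesz_represents_limit[OF _ f(1) s B]
  obtain \<mu> \<nu> where rep: "riesz_represents a b C \<mu> \<nu>"
    using Riesz_representation by blast
  have "(THE x. \<exists>\<mu> \<nu>. riesz_represents a b C \<mu> \<nu> \<and> x = (\<integral>t. f t \<partial>\<mu>) - (\<integral>t. f t \<partial>\<nu>))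
      = (\<integral>t. f t \<partial>\<mu>) - (\<integral>t. f t \<partial>\<nu>)"
  proof (rule the_equality)
    fix x assume "\<exists>\<mu> \<nu>. riesz_represents a b C \<mu> \<nu> \<and> x = (\<integral>t. f t \<partial>\<mu>) - (\<integral>t. f t \<partial>\<nu>)"
    then show "x = (\<integral>t. f t \<partial>\<mu>) - (\<integral>t. f t \<partial>\<nu>)"
      using LIMSEQ_unique[OF lim lim[OF rep]] by blast
  qed (use rep in blast)
  then have "C_ext a b C f = (\<integral>t. f t \<partial>\<mu>) - (\<integral>t. f t \<partial>\<nu>)"
    using f(2) by (simp add: C_ext_def)
  with lim[OF rep] show ?thesis by simp
qed

text \<open>The approximants inherit the sign of \<open>f\<close>, so \<open>C\<close> is
  non-negative on them, and the sign survives in the limit. For continuous \<open>f\<close> the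
  extension is \<open>C\<close> itself.\<close>

lemma C_ext_nonneg:
  assumes f: "continuous_on ({a..b} - {s}) f" and s: "s \<in> {a..b}"
    and B: "\<And>t. t \<in> {a..b} \<Longrightarrow> \<bar>f t\<bar> \<le> B"
    and "\<And>t. t \<in> {a..b} \<Longrightarrow> 0 \<le> f t"
  shows "0 \<le> C_ext a b C f"
proof (cases "continuous_on {a..b} f")
  case True
  then show ?thesis using assms(4) by (auto simp: C_ext_def intro: nonneg)
next
  case False
  have "0 \<le> C (tent_approx f s k)" for k
    using assms(4) s
    by (intro nonneg continuous_on_tent_approx[OF f B] tent_approx_nonneg)
  then show ?thesis
    by (intro LIMSEQ_le_const[OF C_ext_limit[OF f False s B]]) auto
qed

text \<open>The sign is changed at the level of the continuous approximants, where linearity of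
  \<open>C\<close> applies directly, so that linearity of the extension never has to be
  proved.\<close>

lemma C_ext_nonpos:
  assumes f: "continuous_on ({a..b} - {s}) f" and s: "s \<in> {a..b}"
    and B: "\<And>t. t \<in> {a..b} \<Longrightarrow> \<bar>f t\<bar> \<le> B"
    and "\<And>t. t \<in> {a..b} \<Longrightarrow> f t \<le> 0"
  shows "C_ext a b C f \<le> 0"
proof (cases "continuous_on {a..b} f")
  case True
  then have "0 \<le> C (\<lambda>t. - f t)"
    using assms(4) by (intro nonneg continuous_intros) auto
  with True show ?thesis by (simp add: C_ext_def clf_uminus[OF clf])
next
  case False
  have "C (tent_approx f s k) \<le> 0" for k
  proof -
    have c: "continuous_on {a..b} (tent_approx f s k)"
      by (rule continuous_on_tent_approx[OF f B])
    then have "0 \<le> C (\<lambda>t. - tent_approx f s k t)"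
      using assms(4) s tent_approx_nonneg[of "\<lambda>t. - f t" _ s k]
      by (intro nonneg continuous_intros) (auto simp: tent_approx_uminus)
    then show ?thesis by (simp add: clf_uminus[OF clf c])
  qed
  then show ?thesis
    by (intro LIMSEQ_le_const2[OF C_ext_limit[OF f False s B]]) auto
qed

end

section \<open>Slices of the two-point Green's function\<close>

lemma dt_0: "dt a b 0 g t s = g t s"
  by (simp add: dt_def nderiv_def)

text \<open>Both facts are the case \<open>k = 0\<close> of the regularity conditions: continuity is
  inherited from the triangle, and the bound comes from the continuous extension to the compact
  closed triangle.\<close>

lemma regular_on_tri_slice:
  assumes reg: "regular_on_tri a b n p M \<Delta> \<Delta>c g" and "\<Delta> \<subseteq> \<Delta>c" "compact \<Delta>c"
  shows "continuous_on {t. (t, s) \<in> \<Delta>} (\<lambda>t. g t s)"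
    and "\<exists>B. \<forall>t. (t, s) \<in> \<Delta> \<longrightarrow> \<bar>g t s\<bar> \<le> B"
proof -
  have "continuous_on \<Delta> (\<lambda>(t, s). dt a b 0 g t s)"
    using reg unfolding regular_on_tri_def by blast
  then have "continuous_on \<Delta> (\<lambda>(t, s). g t s)"
    by (simp add: dt_0)
  then have "continuous_on {t. (t, s) \<in> \<Delta>} (\<lambda>t. case (t, s) of (t, s) \<Rightarrow> g t s)"
    by (rule continuous_on_compose2) (auto intro!: continuous_intros)
  then show "continuous_on {t. (t, s) \<in> \<Delta>} (\<lambda>t. g t s)"
    by simp
  have "\<exists>h. continuous_on \<Delta>c h \<and> (\<forall>(t, s)\<in>\<Delta>. h (t, s) = dt a b 0 g t s)"
    using reg unfolding regular_on_tri_def by blast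
  then obtain h where h: "continuous_on \<Delta>c h" "\<And>t s. (t, s) \<in> \<Delta> \<Longrightarrow> h (t, s) = g t s"
    by (auto simp: dt_0)
  obtain B where "\<And>x. x \<in> \<Delta>c \<Longrightarrow> norm (h x) \<le> B"
    using compact_imp_bounded[OF compact_continuous_image[OF h(1) assms(3)]]
    by (auto simp: bounded_iff)
  then show "\<exists>B. \<forall>t. (t, s) \<in> \<Delta> \<longrightarrow> \<bar>g t s\<bar> \<le> B"
    using h(2) assms(2) by (metis real_norm_def subsetD)
qed

lemma compact_closed_tri: "compact (closed_lower_tri a b)" "compact (closed_upper_tri a b)"
proof -
  have "closed_lower_tri a b = ({a..b} \<times> {a..b}) \<inter> {x. snd x \<le> fst x}"
    "closed_upper_tri a b = ({a..b} \<times> {a..b}) \<inter> {x. fst x \<le> snd x}"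
    by (auto simp: closed_lower_tri_def closed_upper_tri_def)
  then show "compact (closed_lower_tri a b)" "compact (closed_upper_tri a b)"
    by (auto intro!: compact_Int_closed compact_Times closed_Collect_le continuous_intros)
qed

text \<open>Removing \<open>s\<close> splits the slice into two disjoint, relatively open pieces,
  one in each open triangle, and continuity on the pieces glues. If \<open>s\<close> is an endpoint,
  one piece is empty. The argument is uniform in \<open>n\<close> and covers the diagonal jump for
  \<open>n = 1\<close>.\<close>

lemma green_function_slice:
  assumes g: "is_green_function a b n p M \<alpha> \<beta> g" and s: "s \<in> {a..b}"
  shows "continuous_on ({a..b} - {s}) (\<lambda>t. g t s)"
    and "\<exists>B. \<forall>t\<in>{a..b}. \<bar>g t s\<bar> \<le> B"
proof -
  have lower: "regular_on_tri a b n p M (lower_tri a b) (closed_lower_tri a b) g"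
    and upper: "regular_on_tri a b n p M (upper_tri a b) (closed_upper_tri a b) g"
    using g by (auto simp: is_green_function_def)
  have sub: "lower_tri a b \<subseteq> closed_lower_tri a b" "upper_tri a b \<subseteq> closed_upper_tri a b"
    by (auto simp: lower_tri_def closed_lower_tri_def upper_tri_def closed_upper_tri_def)
  note L = regular_on_tri_slice[OF lower sub(1) compact_closed_tri(1), of s]
  note U = regular_on_tri_slice[OF upper sub(2) compact_closed_tri(2), of s]
  have sets: "{t. (t, s) \<in> lower_tri a b} = {s<..b}" "{t. (t, s) \<in> upper_tri a b} = {a..<s}"
    using s by (auto simp: lower_tri_def upper_tri_def)
  have split: "{a..b} - {s} = {s<..b} \<union> {a..<s}"
    using s by auto
  have "openin (top_of_set ({s<..b} \<union> {a..<s})) {s<..b}"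
    "openin (top_of_set ({s<..b} \<union> {a..<s})) {a..<s}"
  proof -
    have "{s<..b} = ({s<..b} \<union> {a..<s}) \<inter> {s<..}" "{a..<s} = ({s<..b} \<union> {a..<s}) \<inter> {..<s}"
      by auto
    then show "openin (top_of_set ({s<..b} \<union> {a..<s})) {s<..b}"
      "openin (top_of_set ({s<..b} \<union> {a..<s})) {a..<s}"
      by (metis openin_open_Int open_greaterThan open_lessThan)+
  qed
  then show "continuous_on ({a..b} - {s}) (\<lambda>t. g t s)"
    unfolding split using L(1) U(1) unfolding sets
    by (intro continuous_on_Un_local_open)
  obtain B1 B2 where "\<And>t. (t, s) \<in> lower_tri a b \<Longrightarrow> \<bar>g t s\<bar> \<le> B1"
    "\<And>t. (t, s) \<in> upper_tri a b \<Longrightarrow> \<bar>g t s\<bar> \<le> B2"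
    using L(2) U(2) by blast
  moreover have "t = s \<or> (t, s) \<in> lower_tri a b \<or> (t, s) \<in> upper_tri a b" if "t \<in> {a..b}" for t
    using that s by (auto simp: lower_tri_def upper_tri_def)
  \<comment> \<open>The diagonal point lies in neither open triangle, so its own value enters the
    maximum.\<close>
  ultimately show "\<exists>B. \<forall>t\<in>{a..b}. \<bar>g t s\<bar> \<le> B"
    by (intro exI[of _ "max \<bar>g s s\<bar> (max B1 B2)"]) (fastforce simp: le_max_iff_disj)
qed

section \<open>Comparison of the two Green's functions\<close>

theorem corollary2p11:
  fixes a b M :: real and n :: nat
    and p :: "nat \<Rightarrow> real \<Rightarrow> real"
    and \<alpha> \<beta> :: "nat \<Rightarrow> nat \<Rightarrow> real"
    and C :: "(real \<Rightarrow> real) \<Rightarrow> real"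
    and \<delta> :: "nat \<Rightarrow> real"
    and \<omega> :: "nat \<Rightarrow> real \<Rightarrow> real"
    and g :: "real \<Rightarrow> real \<Rightarrow> real"
  assumes "a < b" and "1 \<le> n"
    and "\<And>k. k \<in> {1..n} \<Longrightarrow> continuous_on {a..b} (p k)"
    and "continuous_linear_functional a b C"
    and "\<And>u. solves_bvp a b n p M \<alpha> \<beta> (\<lambda>_. 0) (\<lambda>_. 0) u \<Longrightarrow> \<forall>t\<in>{a..b}. u t = 0"
    and "is_green_function a b n p M \<alpha> \<beta> g"
    and "\<And>j. j \<in> {1..n} \<Longrightarrow>
           solves_bvp a b n p M \<alpha> \<beta> (\<lambda>_. 0) (\<lambda>k. if k = j then 1 else 0) (\<omega> j)"
    and "(\<Sum>i=1..n. \<delta> i * C (\<omega> i)) \<noteq> 1"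
    and "(\<Sum>j=1..n. \<delta> j * C (\<omega> j)) < 1"
    and "\<And>i t. i \<in> {1..n} \<Longrightarrow> t \<in> {a..b} \<Longrightarrow> 0 \<le> \<delta> i * \<omega> i t"
    and "\<And>u. continuous_on {a..b} u \<Longrightarrow> (\<forall>t\<in>{a..b}. 0 \<le> u t) \<Longrightarrow> 0 \<le> C u"
  shows "((\<forall>t\<in>{a..b}. \<forall>s\<in>{a..b}. 0 \<le> g t s) \<longrightarrow>
            (\<forall>t\<in>{a..b}. \<forall>s\<in>{a..b}.
               g t s \<le> nonlocal_green a b n C \<delta> \<omega> g t s \<and> 0 \<le> g t s)) \<and>
         ((\<forall>t\<in>{a..b}. \<forall>s\<in>{a..b}. g t s \<le> 0) \<longrightarrow>
            (\<forall>t\<in>{a..b}. \<forall>s\<in>{a..b}.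
               nonlocal_green a b n C \<delta> \<omega> g t s \<le> g t s \<and> g t s \<le> 0))"
proof -
  interpret positive_functional a b C
    using assms(1,4,11) by unfold_locales auto
  let ?w = "\<lambda>t. (\<Sum>i=1..n. \<delta> i * \<omega> i t) / (1 - (\<Sum>j=1..n. \<delta> j * C (\<omega> j)))"
  \<comment> \<open>Hypothesis (a) makes the denominator positive and (b) the numerator
    non-negative.\<close>
  have w: "0 \<le> ?w t" if "t \<in> {a..b}" for t
    using assms(9) assms(10)[OF _ that] by (intro divide_nonneg_pos sum_nonneg) auto
  have green: "nonlocal_green a b n C \<delta> \<omega> g t s = g t s + ?w t * C_ext a b C (\<lambda>r. g r s)" for t s
    by (simp add: nonlocal_green_def)
  note cont = green_function_slice(1)[OF assms(6)]
  \<comment> \<open>Hypothesis (c) enters here, through the locale: the sign of \<open>g\<close>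
    passes to the extended functional on each slice, and hence to the correction term.\<close>
  have pos: "0 \<le> C_ext a b C (\<lambda>r. g r s)"
    if s: "s \<in> {a..b}" and "\<And>t. t \<in> {a..b} \<Longrightarrow> 0 \<le> g t s" for s
    using green_function_slice(2)[OF assms(6) s] C_ext_nonneg[OF cont[OF s] s] that by blast
  have neg: "C_ext a b C (\<lambda>r. g r s) \<le> 0"
    if s: "s \<in> {a..b}" and "\<And>t. t \<in> {a..b} \<Longrightarrow> g t s \<le> 0" for s
    using green_function_slice(2)[OF assms(6) s] C_ext_nonpos[OF cont[OF s] s] that by blast
  show ?thesis
  proof (intro conjI impI ballI)
    fix t s
    assume ts: "t \<in> {a..b}" "s \<in> {a..b}"
    {
      assume g: "\<forall>t\<in>{a..b}. \<forall>s\<in>{a..b}. 0 \<le> g t s"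
      show "g t s \<le> nonlocal_green a b n C \<delta> \<omega> g t s"
        unfolding green using mult_nonneg_nonneg[OF w[OF ts(1)] pos[OF ts(2)]] g ts(2) by force
      show "0 \<le> g t s"
        using g ts by blast
    next
      assume g: "\<forall>t\<in>{a..b}. \<forall>s\<in>{a..b}. g t s \<le> 0"
      show "nonlocal_green a b n C \<delta> \<omega> g t s \<le> g t s"
        unfolding green using mult_nonneg_nonpos[OF w[OF ts(1)] neg[OF ts(2)]] g ts(2) by force
      show "g t s \<le> 0"
        using g ts by blast
    }
  qed
qed

end
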